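(* Let $G = F,\ (s_1\otimes s_2)\bowtie (t_1\lor t_2)$ be an AC typed forest (with cut), such that $t_1,t_2\neq *$. Then $G' = F,\ s_1\bowtie t_1,\ s_2\bowtie t_2$ is an AC typed forest (with cut) with the same type as $G$.
   Context: **Formulae.** $A ::= a \mid \bar a \mid \top \mid \bot \mid A\land A \mid A\lor A$ ($a$ a proposition symbol); $\bar A$ is the De Morgan dual of $A$. **Expansion trees.** Wire variables come in dual pairs $x,\bar x$. Expansion trees $t$ and witnesses $w$: $t ::= 1 \mid (w+\dots+w) \mid (t\lor t)\mid (t\lor * )\mid ( *\lor t)$, $w ::= x\mid \bar x\mid t\otimes t$, where $(w_1+\dots+w_n)$ is a nonempty finite formal (unordered) sum, called an expansion; $(s_1\otimes s_2)$ denotes the expansion with the single summand $s_1\otimes s_2$. **Types.** A type is a formula or a witness type $[a]$, $[\bar a]$, $A\otimes B$. Typing: $x:[p]$, $\bar x:[\bar p]$; $1:\top$; $(t\lor * ):A\lor B$ if $t:A$; $( *\lor t):A\lor B$ if $t:B$; $(t\lor s):A\lor B$ and $t\otimes s:A\otimes B$ if $t:A,s:B$; $(w_1+\dots+w_n)$ has type $p$, $\bar p$, $A\land B$ if all $w_i$ have type $[p]$, $[\bar p]$, $A\otimes B$ respectively. **Cuts.** A cut tree $t\bowtie s$ is an unordered pair of expansion trees $t:A$, $s:\bar A$ with $A\neq\top,\bot$. A typed forest with cut is a finite collection of typed expansion trees, typed witnesses and cut trees in which each wire variable occurs at most once and $x$ occurs iff $\bar x$ occurs; its type is the collection of types of its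 roots that are not cuts. **AC-correctness.** View a typed forest with cut as a forest of nodes (subterm occurrences, including occurrences of $*$), where a cut $t\bowtie s$ is a root node with successors $t,s$; $(t\lor * )$ has successors $t$ and $*$; an expansion has its summands as successors; wire variables, $1$ and $*$ are leaves. Its graph has an edge from each node to its predecessor and an edge between $x$ and $\bar x$ for each wire variable. Switched nodes are expansions and nodes $t\lor s$ with neither $t$ nor $s$ equal to $*$; all other nodes (in particular cuts, $\otimes$-nodes, $(t\lor * )$ and $( *\lor t)$) are unswitched. A switching chooses one successor of each switched node; its switching graph is obtained from the graph by deleting all edges from the non-chosen successors of switched nodes to those nodes and forgetting directions. The forest is AC (AC-correct) if every switching graph is acyclic. *)

theory Defs
  imports "HOL-Library.Multiset" "HOL-Library.Uprod"
begin

section \<open>Formulae, expansion trees and types\<close>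

datatype 'p form =
    Atom 'p
  | NAtom 'p
  | Top
  | Bot
  | And "'p form" "'p form"
  | Or "'p form" "'p form"

fun dual :: "'p form \<Rightarrow> 'p form" where
  "dual (Atom p) = NAtom p"
| "dual (NAtom p) = Atom p"
| "dual Top = Bot"
| "dual Bot = Top"
| "dual (And A B) = Or (dual A) (dual B)"
| "dual (Or A B) = And (dual A) (dual B)"

text \<open>The dual pair $x, \bar x$ is \<open>Pos x\<close>, \<open>Neg x\<close>.\<close>

datatype 'v wire = Pos 'v | Neg 'v

fun dual_wire :: "'v wire \<Rightarrow> 'v wire" where
  "dual_wire (Pos x) = Neg x"
| "dual_wire (Neg x) = Pos x"

text \<open>
  The symbol $*$ is not itself an expansion tree: \<open>OrL t\<close> is $(t \lor *)$, \<open>OrR t\<close> is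
  $(* \lor t)$, and \<open>TOr t s\<close> is $(t \lor s)$ where neither disjunct is $*$.
  Nonemptiness of the sum in \<open>Exp\<close> is imposed by the typing rules.
\<close>

datatype 'v etree =
    One
  | Exp "'v wit multiset"
  | TOr "'v etree" "'v etree"
  | OrL "'v etree"
  | OrR "'v etree"
and 'v wit =
    Wire "'v wire"
  | Tensor "'v etree" "'v etree"

datatype 'p wtype =
    WAtom 'p
  | WNAtom 'p
  | WTensor "'p form" "'p form"

datatype 'p ty = FormTy "'p form" | WitTy "'p wtype"

text \<open>
  The parameter \<open>\<Gamma>\<close> gives the proposition symbol of each pair of dual wire variables,
  so that $x$ and $\bar x$ receive dual types.
\<close>

inductive tree_type :: "('v \<Rightarrow> 'p) \<Rightarrow> 'v etree \<Rightarrow> 'p form \<Rightarrow> bool"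
  and wit_type :: "('v \<Rightarrow> 'p) \<Rightarrow> 'v wit \<Rightarrow> 'p wtype \<Rightarrow> bool"
  for \<Gamma> :: "'v \<Rightarrow> 'p"
where
  One: "tree_type \<Gamma> One Top"
| OrL: "tree_type \<Gamma> t A \<Longrightarrow> tree_type \<Gamma> (OrL t) (Or A B)"
| OrR: "tree_type \<Gamma> t B \<Longrightarrow> tree_type \<Gamma> (OrR t) (Or A B)"
| TOr: "tree_type \<Gamma> t A \<Longrightarrow> tree_type \<Gamma> s B \<Longrightarrow> tree_type \<Gamma> (TOr t s) (Or A B)"
| Exp_Atom: "M \<noteq> {#} \<Longrightarrow> (\<And>w. w \<in># M \<Longrightarrow> wit_type \<Gamma> w (WAtom p)) \<Longrightarrow>
    tree_type \<Gamma> (Exp M) (Atom p)"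
| Exp_NAtom: "M \<noteq> {#} \<Longrightarrow> (\<And>w. w \<in># M \<Longrightarrow> wit_type \<Gamma> w (WNAtom p)) \<Longrightarrow>
    tree_type \<Gamma> (Exp M) (NAtom p)"
| Exp_And: "M \<noteq> {#} \<Longrightarrow> (\<And>w. w \<in># M \<Longrightarrow> wit_type \<Gamma> w (WTensor A B)) \<Longrightarrow>
    tree_type \<Gamma> (Exp M) (And A B)"
| Pos: "wit_type \<Gamma> (Wire (Pos x)) (WAtom (\<Gamma> x))"
| Neg: "wit_type \<Gamma> (Wire (Neg x)) (WNAtom (\<Gamma> x))"
| Tensor: "tree_type \<Gamma> t A \<Longrightarrow> tree_type \<Gamma> s B \<Longrightarrow> wit_type \<Gamma> (Tensor t s) (WTensor A B)"

section \<open>Forests with cut\<close>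

text \<open>
  Typing is not unique (the absent disjunct of $(t \lor *)$ is arbitrary), so the roots
  which are not cuts carry their types.
\<close>

datatype ('v, 'p) root =
    TreeRoot "'v etree" "'p form"
  | WitRoot "'v wit" "'p wtype"
  | CutRoot "'v etree uprod"

type_synonym ('v, 'p) forest = "('v, 'p) root multiset"

abbreviation cut :: "'v etree \<Rightarrow> 'v etree \<Rightarrow> ('v, 'p) root" (infix "\<bowtie>" 55) where
  "t \<bowtie> s \<equiv> CutRoot (Upair t s)"

inductive root_typed :: "('v \<Rightarrow> 'p) \<Rightarrow> ('v, 'p) root \<Rightarrow> bool" for \<Gamma> :: "'v \<Rightarrow> 'p" where
  "tree_type \<Gamma> t A \<Longrightarrow> root_typed \<Gamma> (TreeRoot t A)"
| "wit_type \<Gamma> w W \<Longrightarrow> root_typed \<Gamma> (WitRoot w W)"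
| "tree_type \<Gamma> t A \<Longrightarrow> tree_type \<Gamma> s (dual A) \<Longrightarrow> A \<noteq> Top \<Longrightarrow> A \<noteq> Bot \<Longrightarrow>
    root_typed \<Gamma> (t \<bowtie> s)"

fun root_type :: "('v, 'p) root \<Rightarrow> 'p ty multiset" where
  "root_type (TreeRoot t A) = {#FormTy A#}"
| "root_type (WitRoot w W) = {#WitTy W#}"
| "root_type (CutRoot c) = {#}"

definition forest_type :: "('v, 'p) forest \<Rightarrow> 'p ty multiset" where
  "forest_type F = (\<Sum>r\<in>#F. root_type r)"

section \<open>Nodes\<close>

datatype 'v label =
    LTree "'v etree"
  | LWit "'v wit"
  | LStar
  | LCut "'v etree uprod"

lift_definition mset_uprod :: "'a uprod \<Rightarrow> 'a multiset" is "\<lambda>(a, b). {#a, b#}"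
  by (auto simp: eq_upair_def add_mset_commute)

lemma mset_uprod_Upair [simp]: "mset_uprod (Upair a b) = {#a, b#}"
  by transfer simp

fun root_label :: "('v, 'p) root \<Rightarrow> 'v label" where
  "root_label (TreeRoot t A) = LTree t"
| "root_label (WitRoot w W) = LWit w"
| "root_label (CutRoot c) = LCut c"

fun succs :: "'v label \<Rightarrow> 'v label multiset" where
  "succs (LTree One) = {#}"
| "succs (LTree (Exp M)) = image_mset LWit M"
| "succs (LTree (TOr t s)) = {#LTree t, LTree s#}"
| "succs (LTree (OrL t)) = {#LTree t, LStar#}"
| "succs (LTree (OrR t)) = {#LStar, LTree t#}"
| "succs (LWit (Wire x)) = {#}"
| "succs (LWit (Tensor t s)) = {#LTree t, LTree s#}"
| "succs LStar = {#}"
| "succs (LCut c) = image_mset LTree (mset_uprod c)"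

text \<open>
  A node (an occurrence) is the path from it up to its root, written with the root last. Since
  forests and sums are multisets, each step \<open>(l, i)\<close> of the path consists of a label and a
  number below the multiplicity of that label among its siblings, so that equal siblings are
  distinct nodes.
\<close>

type_synonym 'v node = "('v label \<times> nat) list"

definition node_label :: "'v node \<Rightarrow> 'v label" where
  "node_label v = fst (hd v)"

inductive_set nodes :: "('v, 'p) forest \<Rightarrow> 'v node set" for F :: "('v, 'p) forest" where
  root: "i < count (image_mset root_label F) l \<Longrightarrow> [(l, i)] \<in> nodes F"
| succ: "v \<in> nodes F \<Longrightarrow> i < count (succs (node_label v)) l \<Longrightarrow> (l, i) # v \<in> nodes F"

definition wire_nodes :: "('v, 'p) forest \<Rightarrow> 'v wire \<Rightarrow> 'v node set" where
  "wire_nodes F x = {v \<in> nodes F. node_label v = LWit (Wire x)}"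

definition typed_forest :: "('v, 'p) forest \<Rightarrow> bool" where
  "typed_forest F \<longleftrightarrow>
     (\<exists>\<Gamma>. \<forall>r \<in># F. root_typed \<Gamma> r) \<and>
     (\<forall>x. \<forall>u \<in> wire_nodes F x. \<forall>v \<in> wire_nodes F x. u = v) \<and>
     (\<forall>x. wire_nodes F x \<noteq> {} \<longleftrightarrow> wire_nodes F (dual_wire x) \<noteq> {})"

section \<open>AC-correctness\<close>

text \<open>An undirected simple graph is given by its set of edges \<open>{u, v}\<close>.\<close>

definition cycle :: "'n set set \<Rightarrow> 'n list \<Rightarrow> bool" where
  "cycle E vs \<longleftrightarrow> length vs \<ge> 3 \<and> distinct vs \<and>
     (\<forall>i < length vs. {vs ! i, vs ! (Suc i mod length vs)} \<in> E)"

definition acyclic_graph :: "'n set set \<Rightarrow> bool" where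
  "acyclic_graph E \<longleftrightarrow> (\<nexists>vs. cycle E vs)"

definition forest_graph :: "('v, 'p) forest \<Rightarrow> 'v node set set" where
  "forest_graph F =
     {{c # v, v} | c v. c # v \<in> nodes F \<and> v \<noteq> []} \<union>
     {{u, v} | u v x. u \<in> wire_nodes F x \<and> v \<in> wire_nodes F (dual_wire x)}"

fun switched :: "'v label \<Rightarrow> bool" where
  "switched (LTree (Exp M)) \<longleftrightarrow> True"
| "switched (LTree (TOr t s)) \<longleftrightarrow> True"
| "switched _ \<longleftrightarrow> False"

text \<open>A switching maps each switched node \<open>v\<close> to the last step \<open>c\<close> of the chosen successor \<open>c # v\<close>.\<close>

definition switching :: "('v, 'p) forest \<Rightarrow> ('v node \<Rightarrow> 'v label \<times> nat) \<Rightarrow> bool" where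
  "switching F \<sigma> \<longleftrightarrow> (\<forall>v \<in> nodes F. switched (node_label v) \<longrightarrow> \<sigma> v # v \<in> nodes F)"

definition switching_graph ::
  "('v, 'p) forest \<Rightarrow> ('v node \<Rightarrow> 'v label \<times> nat) \<Rightarrow> 'v node set set" where
  "switching_graph F \<sigma> = forest_graph F -
     {{c # v, v} | c v. c # v \<in> nodes F \<and> v \<noteq> [] \<and> switched (node_label v) \<and> c \<noteq> \<sigma> v}"

definition AC :: "('v, 'p) forest \<Rightarrow> bool" where
  "AC F \<longleftrightarrow> (\<forall>\<sigma>. switching F \<sigma> \<longrightarrow> acyclic_graph (switching_graph F \<sigma>))"

end

theory Submission
  imports Defs "HOL-Library.Sublist"
begin

text \<open>
  Let \<open>H\<close> be a switching graph of \<open>G'\<close> without the two cut nodes: the part made of \<open>F\<close> and of the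
  subtrees $s_1, s_2, t_1, t_2$. Whichever successor of $t_1 \lor t_2$ is chosen, \<open>H\<close> is also the
  corresponding part of a switching graph of \<open>G\<close>, where in addition the root of $s_1$ is joined to
  that of $s_2$ by a path through the node $s_1 \otimes s_2$, and both are joined to the root of the
  chosen $t_i$ by a path through $s_1 \otimes s_2$, the cut and $t_1 \lor t_2$. As that graph is
  acyclic, \<open>H\<close> is acyclic and does not connect $s_1$ with $s_2$, nor $s_i$ with $t_j$ for any \<open>i\<close>
  and \<open>j\<close> (lemma \<open>subtrees_not_connected\<close>). It may connect $t_1$ with $t_2$, but this does no harm:
  a cycle that passes through both $s_1 \bowtie t_1$ and $s_2 \bowtie t_2$ needs two connections, and
  at least one of them starts in $s_2$ and ends in $s_1$ or $t_1$. A cycle through only one of the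
  cuts needs a connection between $s_i$ and $t_i$. Hence \<open>G'\<close> is AC (lemma \<open>AC_reduct\<close>).

  The argument uses connectedness instead of explicit cycles: a graph stays acyclic under the
  insertion of an edge between unconnected vertices (\<open>acyclic_insert_edge\<close>), and the ends of an edge
  of an acyclic graph are unconnected once it is removed (\<open>acyclic_edge_is_bridge\<close>).

  Since nodes are paths down to the root, the four subtrees consist of different nodes in \<open>G\<close> and in
  \<open>G'\<close>. They are identified by a map that exchanges the lower ends of the paths (\<open>regraft\<close>). It
  preserves labels and the successor relation, and with them wires and switchings.
\<close>

section \<open>Cycles and connectivity in undirected graphs\<close>

definition connects :: "'n set set \<Rightarrow> 'n \<Rightarrow> 'n \<Rightarrow> bool" where
  "connects E = (\<lambda>u v. {u, v} \<in> E)\<^sup>*\<^sup>*"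

lemma connects_refl [simp]: "connects E u u"
  by (simp add: connects_def)

lemma connects_edge: "{u, v} \<in> E \<Longrightarrow> connects E u v"
  by (auto simp: connects_def)

lemma connects_trans: "connects E u v \<Longrightarrow> connects E v w \<Longrightarrow> connects E u w"
  by (simp add: connects_def)

lemma connects_sym: "connects E u v \<longleftrightarrow> connects E v u"
proof -
  have "symp (\<lambda>u v. {u, v} \<in> E)"
    by (auto intro: sympI simp: insert_commute)
  then show ?thesis
    unfolding connects_def by (metis symp_rtranclp sympD)
qed

lemma connects_mono: "connects E u v \<Longrightarrow> E \<subseteq> E' \<Longrightarrow> connects E' u v"
  unfolding connects_def by (erule rtranclp_mono[THEN predicate2D, rotated]) auto

lemma connects_isolated: "connects E u v \<Longrightarrow> u \<notin> \<Union>E \<Longrightarrow> v = u"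
  unfolding connects_def by (induction rule: rtranclp_induct) auto

lemma connects_image: "connects E u v \<Longrightarrow> connects ((`) f ` E) (f u) (f v)"
  unfolding connects_def
proof (induction rule: rtranclp_induct)
  case (step y z)
  have "{f y, f z} = f ` {y, z}" by simp
  with step show ?case by (metis (mono_tags, lifting) imageI rtranclp.rtrancl_into_rtrancl)
qed simp

text \<open>
  A walk that uses the new edge can be cut short so that it crosses it once, in one of the two
  directions; the parts before and after the crossing stay in \<open>E\<close>.
\<close>

lemma connects_insert:
  assumes "connects (insert {u, v} E) a b"
  shows "connects E a b \<or> connects E a u \<and> connects E v b \<or> connects E a v \<and> connects E u b"
  using assms unfolding connects_def[of "insert _ _"]
proof (induction rule: rtranclp_induct)
  case (step y z)
  from step.hyps(2) have "{y, z} \<in> E \<or> y = u \<and> z = v \<or> y = v \<and> z = u"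
    by (auto simp: doubleton_eq_iff)
  with step.IH show ?case
    by (meson connects_edge connects_refl connects_trans)
qed simp

lemma connects_distinct_path:
  assumes "connects E u v"
  shows "\<exists>xs. xs \<noteq> [] \<and> hd xs = u \<and> last xs = v \<and> distinct xs \<and>
    (\<forall>i. Suc i < length xs \<longrightarrow> {xs ! i, xs ! Suc i} \<in> E)"
  using assms unfolding connects_def
proof (induction rule: rtranclp_induct)
  case base
  show ?case by (intro exI[of _ "[u]"]) auto
next
  case (step y z)
  then obtain xs where xs: "xs \<noteq> []" "hd xs = u" "last xs = y" "distinct xs"
    "\<And>i. Suc i < length xs \<Longrightarrow> {xs ! i, xs ! Suc i} \<in> E" by blast
  show ?case
  proof (cases "z \<in> set xs")
    case True
    then obtain ys zs where split: "xs = ys @ z # zs" by (meson split_list)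
    have "{(ys @ [z]) ! i, (ys @ [z]) ! Suc i} \<in> E" if "Suc i < length (ys @ [z])" for i
      using xs(5)[of i] that by (auto simp: split nth_append less_Suc_eq)
    then show ?thesis
      using xs split by (intro exI[of _ "ys @ [z]"]) (auto simp: hd_append)
  next
    case False
    have "{(xs @ [z]) ! i, (xs @ [z]) ! Suc i} \<in> E" if "Suc i < length (xs @ [z])" for i
    proof (cases "Suc i < length xs")
      case False
      with that have "i = length xs - 1" using xs(1) by (cases xs) auto
      then show ?thesis using step.hyps(2) xs(1,3) by (auto simp: nth_append last_conv_nth)
    qed (use xs(5) in \<open>auto simp: nth_append\<close>)
    then show ?thesis using xs False by (intro exI[of _ "xs @ [z]"]) auto
  qed
qed

text \<open>
  A walk avoiding the edge can be shortened to a simple path, which the edge closes to a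
  cycle. The path has at least three vertices because the edge itself, the only possible path
  with two, is excluded.
\<close>

lemma acyclic_edge_is_bridge:
  assumes "acyclic_graph E" "{u, v} \<in> E" "u \<noteq> v"
  shows "\<not> connects (E - {{u, v}}) u v"
proof
  assume "connects (E - {{u, v}}) u v"
  then obtain xs where xs: "xs \<noteq> []" "hd xs = u" "last xs = v" "distinct xs"
    "\<And>i. Suc i < length xs \<Longrightarrow> {xs ! i, xs ! Suc i} \<in> E - {{u, v}}"
    using connects_distinct_path by metis
  have ends: "xs ! 0 = u" "xs ! (length xs - 1) = v"
    using xs(1-3) by (simp_all add: hd_conv_nth last_conv_nth)
  have "length xs \<noteq> 0" using xs(1) by simp
  moreover have "length xs \<noteq> 1" using ends assms(3) by auto
  moreover have "length xs \<noteq> 2" using ends xs(5)[of 0] by auto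
  ultimately have len: "length xs \<ge> 3" by linarith
  have "{xs ! i, xs ! (Suc i mod length xs)} \<in> E" if "i < length xs" for i
  proof (cases "Suc i < length xs")
    case True
    then show ?thesis using xs(5) by simp
  next
    case False
    then have "i = length xs - 1" "Suc i = length xs" using that by auto
    then show ?thesis using ends assms(2) by (simp add: insert_commute)
  qed
  then have "cycle E xs" using len xs(4) by (simp add: cycle_def)
  then show False using assms(1) by (auto simp: acyclic_graph_def)
qed

lemma cycle_rotate:
  assumes "cycle E vs"
  shows "cycle E (rotate k vs)"
proof -
  let ?n = "length vs"
  have n: "?n \<ge> 3" using assms by (simp add: cycle_def)
  have "{rotate k vs ! i, rotate k vs ! (Suc i mod ?n)} \<in> E" if "i < ?n" for i
  proof -
    have "(k + i) mod ?n < ?n" "Suc i mod ?n < ?n" using n by (auto intro: mod_less_divisor)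
    moreover have "(k + Suc i mod ?n) mod ?n = Suc ((k + i) mod ?n) mod ?n"
      by (simp add: mod_simps)
    ultimately show ?thesis
      using assms that by (simp add: cycle_def nth_rotate)
  qed
  then show ?thesis using assms by (simp add: cycle_def)
qed

text \<open>
  A cycle of the larger graph has to use the new edge. After a rotation that edge is the closing
  one, and the rest of the cycle is a walk in \<open>E\<close> between its two ends.
\<close>

lemma acyclic_insert_edge:
  assumes "acyclic_graph E" "\<not> connects E u v"
  shows "acyclic_graph (insert {u, v} E)"
  unfolding acyclic_graph_def
proof
  assume "\<exists>vs. cycle (insert {u, v} E) vs"
  then obtain vs where vs: "cycle (insert {u, v} E) vs" by blast
  from assms(1) have "\<not> cycle E vs" by (simp add: acyclic_graph_def)
  with vs obtain k where k: "k < length vs" "{vs ! k, vs ! (Suc k mod length vs)} = {u, v}"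
    unfolding cycle_def by blast
  define ws where "ws = rotate (Suc k) vs"
  define m where "m = length vs - 1"
  have ws: "cycle (insert {u, v} E) ws" unfolding ws_def using vs by (rule cycle_rotate)
  then have len: "length ws = Suc m" "m \<ge> 2" "distinct ws"
    by (auto simp: cycle_def m_def ws_def)
  have m: "length vs = Suc m" using len by (simp add: ws_def)
  have "(Suc k + m) mod length vs = k" using k(1) mod_add_self2[of k "Suc m"] by (simp add: m)
  then have "ws ! m = vs ! k"
    unfolding ws_def by (subst nth_rotate) (simp_all add: m)
  moreover have "ws ! 0 = vs ! (Suc k mod length vs)"
    unfolding ws_def by (subst nth_rotate) (simp_all add: m)
  ultimately have ends: "{ws ! m, ws ! 0} = {u, v}" using k(2) by simp
  have edge: "{ws ! i, ws ! Suc i} \<in> E" if "i < m" for i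
  proof -
    have "{ws ! i, ws ! Suc i} \<in> insert {u, v} E"
      using ws that len(1) unfolding cycle_def by (metis Suc_mono less_SucI mod_less)
    moreover have "{ws ! i, ws ! Suc i} \<noteq> {ws ! m, ws ! 0}"
      using that len by (auto simp: doubleton_eq_iff nth_eq_iff_index_eq)
    ultimately show ?thesis using ends by simp
  qed
  have "connects E (ws ! 0) (ws ! i)" if "i \<le> m" for i
    using that
  proof (induction i)
    case (Suc i)
    then show ?case using edge[of i] connects_edge connects_trans by (metis Suc_leD Suc_le_lessD)
  qed simp
  then have "connects E (ws ! 0) (ws ! m)" by simp
  then have "connects E u v"
    using ends connects_sym by (metis doubleton_eq_iff)
  with assms(2) show False ..
qed

lemma acyclic_subset: "acyclic_graph E \<Longrightarrow> E' \<subseteq> E \<Longrightarrow> acyclic_graph E'"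
  unfolding acyclic_graph_def cycle_def by blast

lemma acyclic_inj_image:
  assumes "acyclic_graph ((`) f ` E)" "inj_on f (\<Union>E)"
  shows "acyclic_graph E"
  unfolding acyclic_graph_def
proof
  assume "\<exists>vs. cycle E vs"
  then obtain vs where vs: "cycle E vs" by blast
  have "set vs \<subseteq> \<Union>E"
    using vs unfolding cycle_def in_set_conv_nth subset_iff by (metis UnionI insertI1)
  then have "distinct (map f vs)"
    using vs assms(2) by (auto simp: cycle_def distinct_map intro: inj_on_subset)
  moreover have "{map f vs ! i, map f vs ! (Suc i mod length vs)} \<in> (`) f ` E"
    if "i < length vs" for i
  proof -
    have "Suc i mod length vs < length vs" using that by (intro mod_less_divisor) auto
    then have "{map f vs ! i, map f vs ! (Suc i mod length vs)}
        = f ` {vs ! i, vs ! (Suc i mod length vs)}"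
      using that by simp
    then show ?thesis using vs that unfolding cycle_def by blast
  qed
  ultimately have "cycle ((`) f ` E) (map f vs)"
    using vs by (simp add: cycle_def)
  then show False using assms(1) by (auto simp: acyclic_graph_def)
qed

text \<open>
  A path \<open>u - c - v\<close> through a vertex outside of \<open>E\<close> acts as an edge from \<open>u\<close> to \<open>v\<close>
  would. This is how a cut whose two subtrees have roots \<open>u\<close> and \<open>v\<close> enters a switching graph.
\<close>

lemma connects_subdivided_edge:
  assumes "connects ({{c, u}, {c, v}} \<union> E) a b" "c \<notin> \<Union>E" "a \<noteq> c" "b \<noteq> c"
  shows "connects E a b \<or> connects E a u \<and> connects E v b \<or> connects E a v \<and> connects E u b"
proof -
  have iso: "\<not> connects E a c" "\<not> connects E c b"
    using connects_isolated[of E c] assms(2-4) connects_sym by metis+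
  have ins: "connects (insert {c, v} E) x y \<Longrightarrow>
     connects E x y \<or> connects E x c \<and> connects E v y \<or> connects E x v \<and> connects E c y" for x y
    by (rule connects_insert)
  have "connects (insert {c, u} (insert {c, v} E)) a b" using assms(1) by simp
  from connects_insert[OF this] ins iso show ?thesis
    by (meson connects_sym connects_trans)
qed

lemma acyclic_subdivided_edge:
  assumes "acyclic_graph E" "\<not> connects E u v" "c \<notin> \<Union>E" "c \<noteq> u" "c \<noteq> v"
  shows "acyclic_graph ({{c, u}, {c, v}} \<union> E)"
proof -
  have iso: "\<not> connects E c u" "\<not> connects E c v"
    using connects_isolated assms(3-5) by metis+
  have "acyclic_graph (insert {c, v} E)"
    using assms(1) iso(2) by (rule acyclic_insert_edge)
  moreover have "\<not> connects (insert {c, v} E) c u"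
    using connects_insert[of c v E c u] iso assms(2) connects_sym by metis
  ultimately show ?thesis using acyclic_insert_edge by fastforce
qed

section \<open>Nodes as branches\<close>

text \<open>
  The subtree at the occurrence \<open>b\<close>. The rules mention no forest: what grows on \<open>b\<close> depends
  only on the label of \<open>b\<close>, so that equal subtrees at different places have the same branches up
  to the suffix.
\<close>

inductive_set branch :: "'v node \<Rightarrow> 'v node set" for b :: "'v node" where
  base: "b \<in> branch b"
| step: "v \<in> branch b \<Longrightarrow> i < count (succs (node_label v)) l \<Longrightarrow> (l, i) # v \<in> branch b"

definition steps :: "'v label multiset \<Rightarrow> ('v label \<times> nat) set" where
  "steps M = {(l, i). i < count M l}"

lemma node_label_append: "b \<noteq> [] \<Longrightarrow> node_label (p @ b) = node_label (if p = [] then b else p)"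
  by (simp add: node_label_def)

lemma branch_suffix: "v \<in> branch b \<Longrightarrow> \<exists>p. v = p @ b"
  by (induction rule: branch.induct) (auto intro: exI[of _ "_ # _"])

lemma branch_not_Nil: "v \<in> branch b \<Longrightarrow> b \<noteq> [] \<Longrightarrow> v \<noteq> []"
  using branch_suffix by fastforce

lemma branch_transfer:
  assumes "p @ b \<in> branch b" "b \<noteq> []" "b' \<noteq> []" "node_label b' = node_label b"
  shows "p @ b' \<in> branch b'"
  using assms(1)
proof (induction p)
  case (Cons c p)
  obtain l i where c: "c = (l, i)" by (cases c)
  have "c # (p @ b) \<in> branch b" using Cons.prems by simp
  then have "p @ b \<in> branch b \<and> i < count (succs (node_label (p @ b))) l"
  proof cases
    case base
    then have "length (c # p @ b) = length b" by simp
    then show ?thesis by simp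
  qed (auto simp: c)
  moreover have "node_label (p @ b') = node_label (p @ b)"
    using assms(2-4) by (simp add: node_label_append)
  ultimately show ?case using Cons.IH by (auto simp: c intro: branch.step)
qed (simp add: branch.base)

lemma branch_unfold:
  assumes "b \<noteq> []"
  shows "branch b = insert b (\<Union>c \<in> steps (succs (node_label b)). branch (c # b))"
proof (intro equalityI subsetI)
  fix v assume "v \<in> branch b"
  then show "v \<in> insert b (\<Union>c \<in> steps (succs (node_label b)). branch (c # b))"
  proof (induction rule: branch.induct)
    case (step v i l)
    from step.IH show ?case
    proof
      assume "v = b"
      then show ?thesis using step.hyps(2) by (auto simp: steps_def intro!: bexI[of _ "(l, i)"] branch.base)
    qed (use step.hyps(2) in \<open>auto intro: branch.step\<close>)
  qed simp
next
  fix v assume "v \<in> insert b (\<Union>c \<in> steps (succs (node_label b)). branch (c # b))"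
  moreover have "v \<in> branch b" if "c \<in> steps (succs (node_label b))" "v \<in> branch (c # b)" for c
    using that(2)
    by (induction rule: branch.induct)
      (use that(1) in \<open>auto simp: steps_def intro: branch.step branch.base\<close>)
  ultimately show "v \<in> branch b" by (auto intro: branch.base)
qed

lemma nodes_not_Nil: "v \<in> nodes F \<Longrightarrow> v \<noteq> []"
  by (induction rule: nodes.induct) auto

lemma Cons_in_nodes:
  assumes "v \<noteq> []"
  shows "(l, i) # v \<in> nodes F \<longleftrightarrow> v \<in> nodes F \<and> i < count (succs (node_label v)) l"
  using assms by (auto intro: nodes.succ elim: nodes.cases)

lemma nodes_eq_branches: "nodes F = (\<Union>c \<in> steps (image_mset root_label F). branch [c])"
proof (intro equalityI subsetI)
  fix v assume "v \<in> nodes F"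
  then show "v \<in> (\<Union>c \<in> steps (image_mset root_label F). branch [c])"
    by (induction rule: nodes.induct) (auto simp: steps_def intro: branch.intros)
next
  fix v assume "v \<in> (\<Union>c \<in> steps (image_mset root_label F). branch [c])"
  then obtain c where c: "c \<in> steps (image_mset root_label F)" "v \<in> branch [c]" by blast
  from c(2) show "v \<in> nodes F"
    by (induction rule: branch.induct) (use c(1) in \<open>auto simp: steps_def intro: nodes.intros\<close>)
qed

lemma steps_add_mset: "steps (add_mset l M) = insert (l, count M l) (steps M)"
  by (auto simp: steps_def less_Suc_eq split: if_splits)

lemma steps_pair: "steps {#a, b#} = {(a, 0), (b, if a = b then 1 else 0)}"
  by (auto simp: steps_def split: if_splits)

lemma steps_single: "steps {#a#} = {(a, 0)}"
  by (auto simp: steps_def split: if_splits)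

text \<open>
  The new root takes the first number which its equals in \<open>F\<close> leave free, and so the nodes of
  \<open>F\<close> keep their names.
\<close>

lemma nodes_add_root:
  "nodes (add_mset r F) =
     branch [(root_label r, count (image_mset root_label F) (root_label r))] \<union> nodes F"
  by (simp add: nodes_eq_branches steps_add_mset)

lemma last_node: "v \<in> nodes F \<Longrightarrow> last v \<in> steps (image_mset root_label F)"
  by (induction rule: nodes.induct) (auto simp: steps_def dest: nodes_not_Nil)

section \<open>Regrafting\<close>

text \<open>
  Moving subtrees: a node \<open>p @ b\<close> on a branch with \<open>(b, b')\<close> in the list becomes \<open>p @ b'\<close>, and
  a node on none of the listed branches stays where it is.
\<close>

fun regraft :: "('v node \<times> 'v node) list \<Rightarrow> 'v node \<Rightarrow> 'v node" where
  "regraft m [] = []"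
| "regraft m (c # v) = (case map_of m (c # v) of Some b \<Rightarrow> b | None \<Rightarrow> c # regraft m v)"

text \<open>
  No listed node lies on the branch of another, so that the branches are disjoint. Regrafting
  from one such list of nodes to another is inverted by the reversed pairs.
\<close>

definition incomparable :: "'v node list \<Rightarrow> bool" where
  "incomparable bs \<longleftrightarrow> distinct bs \<and> [] \<notin> set bs \<and>
     (\<forall>a \<in> set bs. \<forall>b \<in> set bs. suffix a b \<longrightarrow> a = b)"

lemma regraft_branch:
  assumes "incomparable (map fst m)" "(b, b') \<in> set m"
  shows "regraft m (p @ b) = p @ b'"
proof (induction p)
  case Nil
  have "map_of m b = Some b'" "b \<noteq> []"
    using assms by (force simp: incomparable_def)+
  then show ?case by (cases b) auto
next
  case (Cons c p)
  have "map_of m (c # p @ b) = None"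
  proof (rule ccontr)
    assume "map_of m (c # p @ b) \<noteq> None"
    then have "c # p @ b \<in> set (map fst m)" by (simp add: map_of_eq_None_iff)
    moreover have "b \<in> set (map fst m)" using assms(2) by force
    moreover have "suffix b (c # p @ b)" by (auto simp: suffix_def intro: exI[of _ "c # p"])
    ultimately have "b = c # p @ b" using assms(1) unfolding incomparable_def by blast
    then have "length b = length (c # p @ b)" by simp
    then show False by simp
  qed
  then show ?case using Cons by simp
qed

lemma regraft_other:
  assumes "\<And>b. b \<in> set (map fst m) \<Longrightarrow> \<not> suffix b v"
  shows "regraft m v = v"
  using assms
proof (induction v)
  case (Cons c v)
  have "map_of m (c # v) = None" using Cons.prems by (auto simp: map_of_eq_None_iff)
  moreover have "regraft m v = v"
    using Cons by (meson suffix_ConsI)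
  ultimately show ?case by simp
qed simp

section \<open>Switching graphs\<close>

text \<open>
  The difference of edge sets in the definition of the switching graph removes exactly the edges
  that it is meant to remove: an edge determines which of its ends is the parent, and a wire edge,
  whose ends are leaves, is never one of the removed ones.
\<close>

lemma switching_graph_eq:
  "switching_graph F \<sigma> =
     {{c # v, v} | c v. c # v \<in> nodes F \<and> v \<noteq> [] \<and> (switched (node_label v) \<longrightarrow> c = \<sigma> v)} \<union>
     {{u, v} | u v x. u \<in> wire_nodes F x \<and> v \<in> wire_nodes F (dual_wire x)}"
  (is "_ = ?P \<union> ?W")
proof -
  let ?D = "{{c # v, v} | c v. c # v \<in> nodes F \<and> v \<noteq> [] \<and> switched (node_label v) \<and> c \<noteq> \<sigma> v}"
  have "c # v = c' # v'" if "{c # v, v} = {c' # v', v'}" for c c' :: "'a label \<times> nat" and v v'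
  proof (rule ccontr)
    assume "c # v \<noteq> c' # v'"
    with that have "c # v = v'" "v = c' # v'" unfolding doubleton_eq_iff by blast+
    then have "length v = Suc (Suc (length v))" by (metis length_Cons)
    then show False by simp
  qed
  then have PD: "E \<notin> ?D" if "E \<in> ?P" for E using that by blast
  have WD: "E \<notin> ?D" if "E \<in> ?W" for E
  proof
    obtain u w x where E: "E = {u, w}" "u \<in> wire_nodes F x" "w \<in> wire_nodes F (dual_wire x)"
      using \<open>E \<in> ?W\<close> by blast
    assume "E \<in> ?D"
    then obtain c v where v: "E = {c # v, v}" "switched (node_label v)" by blast
    then have "v = u \<or> v = w" using E(1) by blast
    with v(2) E(2,3) show False by (auto simp: wire_nodes_def)
  qed
  have all: "{{c # v, v} | c v. c # v \<in> nodes F \<and> v \<noteq> []} = ?P \<union> ?D" by blast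
  \<comment> \<open>Stated for variables to keep the set comprehensions folded.\<close>
  have diff: "(X \<union> Y \<union> Z) - Y = X \<union> Z"
    if "\<And>E. E \<in> X \<Longrightarrow> E \<notin> Y" "\<And>E. E \<in> Z \<Longrightarrow> E \<notin> Y" for X Y Z :: "'a node set set"
    using that by blast
  show ?thesis
    unfolding switching_graph_def forest_graph_def all by (rule diff[OF PD WD])
qed

section \<open>The nodes of a cut and of its reduct\<close>

text \<open>
  The nodes of the two forests are compared as follows. In \<open>G\<close> the cut is the tree

    \<open>s1N, s2N -> tensorN -> expN -> cutN <- orN <- t1N, t2N\<close>

  (arrows lead to predecessors), and in \<open>G'\<close> it becomes the two trees
  \<open>s1N' -> cut1N <- t1N'\<close> and \<open>s2N' -> cut2N <- t2N'\<close>. What remains of each forest when the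
  nodes in the middle are left out, its core, consists of \<open>F\<close> and of the four branches, and the
  cores are isomorphic by regrafting. The conditionals in the numbers below take care of siblings
  which happen to be equal.
\<close>

locale tensor_or_cut =
  fixes F :: "('v, 'p) forest" and s1 s2 t1 t2 :: "'v etree"
begin

definition "G = F + {#Exp {#Tensor s1 s2#} \<bowtie> TOr t1 t2#}"
definition "G' = F + {#s1 \<bowtie> t1, s2 \<bowtie> t2#}"

definition added_root :: "'v label multiset \<Rightarrow> 'v label \<Rightarrow> 'v node" where
  "added_root M l = [(l, count M l)]"

lemma added_root_neq: "added_root (add_mset l' M) l \<noteq> added_root M l'"
  by (auto simp: added_root_def)

abbreviation "roots \<equiv> image_mset root_label F"

definition "cutN = added_root roots (LCut (Upair (Exp {#Tensor s1 s2#}) (TOr t1 t2)))"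
definition "expN = (LTree (Exp {#Tensor s1 s2#}), 0) # cutN"
definition "orN = (LTree (TOr t1 t2), 0) # cutN"
definition "tensorN = (LWit (Tensor s1 s2), 0) # expN"

definition "s1N = (LTree s1, 0) # tensorN"
definition "s2N = (LTree s2, if s1 = s2 then 1 else 0) # tensorN"
definition "t1N = (LTree t1, 0) # orN"
definition "t2N = (LTree t2, if t1 = t2 then 1 else 0) # orN"

text \<open>
  The two new cuts may be equal; \<open>cut1N\<close> is numbered as if \<open>cut2N\<close> had been added before it.
\<close>

definition "cut1N = added_root (add_mset (LCut (Upair s2 t2)) roots) (LCut (Upair s1 t1))"
definition "cut2N = added_root roots (LCut (Upair s2 t2))"

definition "s1N' = (LTree s1, 0) # cut1N"
definition "t1N' = (LTree t1, if s1 = t1 then 1 else 0) # cut1N"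
definition "s2N' = (LTree s2, 0) # cut2N"
definition "t2N' = (LTree t2, if s2 = t2 then 1 else 0) # cut2N"

definition "core = nodes F \<union> branch s1N \<union> branch s2N \<union> branch t1N \<union> branch t2N"
definition "core' = nodes F \<union> branch s1N' \<union> branch s2N' \<union> branch t1N' \<union> branch t2N'"

lemmas subtree_defs = s1N_def s2N_def t1N_def t2N_def s1N'_def s2N'_def t1N'_def t2N'_def

lemma nodes_G: "nodes G = core \<union> {cutN, expN, orN, tensorN}"
proof -
  have "nodes G = branch cutN \<union> nodes F"
    by (simp add: G_def nodes_add_root cutN_def added_root_def)
  moreover have "branch cutN = insert cutN (branch expN \<union> branch orN)"
    by (subst branch_unfold)
      (simp_all add: cutN_def expN_def orN_def added_root_def node_label_def steps_pair)
  moreover have "branch expN = insert expN (branch tensorN)"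
    by (subst branch_unfold) (simp_all add: expN_def tensorN_def node_label_def steps_single)
  moreover have "branch tensorN = insert tensorN (branch s1N \<union> branch s2N)"
    by (subst branch_unfold)
      (simp_all add: tensorN_def s1N_def s2N_def node_label_def steps_pair)
  moreover have "branch orN = insert orN (branch t1N \<union> branch t2N)"
    by (subst branch_unfold) (simp_all add: orN_def t1N_def t2N_def node_label_def steps_pair)
  ultimately show ?thesis by (auto simp: core_def)
qed

lemma nodes_G': "nodes G' = core' \<union> {cut1N, cut2N}"
proof -
  have "nodes G' = branch cut1N \<union> branch cut2N \<union> nodes F"
    by (simp add: G'_def nodes_add_root cut1N_def cut2N_def added_root_def Un_assoc)
  moreover have "branch cut1N = insert cut1N (branch s1N' \<union> branch t1N')"
    by (subst branch_unfold)
      (simp_all add: cut1N_def s1N'_def t1N'_def added_root_def node_label_def steps_pair)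
  moreover have "branch cut2N = insert cut2N (branch s2N' \<union> branch t2N')"
    by (subst branch_unfold)
      (simp_all add: cut2N_def s2N'_def t2N'_def added_root_def node_label_def steps_pair)
  ultimately show ?thesis by (auto simp: core'_def)
qed

section \<open>The isomorphism of the cores\<close>

text \<open>
  The map goes from \<open>G'\<close> to \<open>G\<close>, as it is to transport a given switching of \<open>G'\<close> and its edges.
\<close>

definition "moves = [(s1N', s1N), (s2N', s2N), (t1N', t1N), (t2N', t2N)]"

lemma cuts_distinct: "cut1N \<noteq> cut2N"
  unfolding cut1N_def cut2N_def by (rule added_root_neq)

lemma cut_node_singleton: "\<exists>c. cutN = [c]" "\<exists>c. cut1N = [c]" "\<exists>c. cut2N = [c]"
  by (simp_all add: cutN_def cut1N_def cut2N_def added_root_def)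

lemma incomparable_moves:
  "incomparable (map fst moves)" "incomparable (map snd moves)"
proof -
  obtain c c1 c2 where c: "cutN = [c]" "cut1N = [c1]" "cut2N = [c2]"
    using cut_node_singleton by blast
  with cuts_distinct have "c1 \<noteq> c2" by simp
  with c show "incomparable (map fst moves)" "incomparable (map snd moves)"
    by (simp_all add: incomparable_def moves_def subtree_defs tensorN_def orN_def expN_def
        suffix_Cons)
qed

lemma nodes_F_not_above_cut:
  assumes "v \<in> nodes F" "b \<in> {cutN, cut1N, cut2N}"
  shows "\<not> suffix (p @ b) v"
proof
  assume "suffix (p @ b) v"
  then have "last v = last b"
    using assms(2) by (auto simp: suffix_def cutN_def cut1N_def cut2N_def added_root_def)
  then show False using last_node[OF assms(1)] assms(2)
    by (auto simp: steps_def cutN_def cut1N_def cut2N_def added_root_def split: if_splits)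
qed

definition "graft = regraft moves"
definition "ungraft = regraft (map prod.swap moves)"

lemma moves_labels:
  "(b', b) \<in> set moves \<Longrightarrow> b' \<noteq> [] \<and> b \<noteq> [] \<and> node_label b = node_label b'"
  by (auto simp: moves_def subtree_defs node_label_def)

lemma graft_append: "(b', b) \<in> set moves \<Longrightarrow> graft (p @ b') = p @ b"
  unfolding graft_def using incomparable_moves(1) by (rule regraft_branch)

lemma ungraft_append: "(b', b) \<in> set moves \<Longrightarrow> ungraft (p @ b) = p @ b'"
  unfolding ungraft_def
  by (rule regraft_branch) (use incomparable_moves(2) in \<open>force simp: comp_def\<close>)+

lemma
  assumes "v \<in> nodes F"
  shows graft_F: "graft v = v" and ungraft_F: "ungraft v = v"
proof -
  have *: "\<not> suffix (p @ cutN) v" "\<not> suffix (p @ cut1N) v" "\<not> suffix (p @ cut2N) v" for p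
    using nodes_F_not_above_cut[OF assms] by blast+
  have not1: "\<not> suffix (x # cut1N) v" "\<not> suffix (x # cut2N) v" for x
    using *(2,3)[of "[x]"] by simp_all
  have not2: "\<not> suffix (x # y # cutN) v" "\<not> suffix (x # y # z # cutN) v" for x y z
    using *(1)[of "[x, y]"] *(1)[of "[x, y, z]"] by simp_all
  show "graft v = v" unfolding graft_def
    by (rule regraft_other) (use not1 in \<open>auto simp: moves_def s1N'_def s2N'_def t1N'_def t2N'_def\<close>)
  show "ungraft v = v" unfolding ungraft_def
    by (rule regraft_other)
      (use not2 in \<open>auto simp: moves_def s1N_def s2N_def t1N_def t2N_def tensorN_def expN_def orN_def\<close>)
qed

lemma core'_iff: "v \<in> core' \<longleftrightarrow> v \<in> nodes F \<or> (\<exists>(b', b) \<in> set moves. v \<in> branch b')"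
  by (auto simp: core'_def moves_def)

lemma core_iff: "v \<in> core \<longleftrightarrow> v \<in> nodes F \<or> (\<exists>(b', b) \<in> set moves. v \<in> branch b)"
  by (auto simp: core_def moves_def)

text \<open>
  The label is preserved because corresponding branches start from the same subtree.
\<close>

lemma graft_core:
  assumes "v \<in> core'"
  shows "graft v \<in> core \<and> ungraft (graft v) = v \<and> node_label (graft v) = node_label v"
  using assms[unfolded core'_iff]
proof
  assume "v \<in> nodes F"
  then show ?thesis by (simp add: graft_F ungraft_F core_iff)
next
  assume "\<exists>(b', b) \<in> set moves. v \<in> branch b'"
  then obtain b b' p where b: "(b', b) \<in> set moves" "p @ b' \<in> branch b'" "v = p @ b'"
    using branch_suffix by blast
  then have "p @ b \<in> branch b"
    using branch_transfer moves_labels by metis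
  then show ?thesis
    using b moves_labels[OF b(1)]
    by (auto simp: graft_append ungraft_append core_iff node_label_append)
qed

lemma ungraft_core:
  assumes "v \<in> core"
  shows "ungraft v \<in> core' \<and> graft (ungraft v) = v"
  using assms[unfolded core_iff]
proof
  assume "v \<in> nodes F"
  then show ?thesis by (simp add: graft_F ungraft_F core'_iff)
next
  assume "\<exists>(b', b) \<in> set moves. v \<in> branch b"
  then obtain b b' p where b: "(b', b) \<in> set moves" "p @ b \<in> branch b" "v = p @ b"
    using branch_suffix by blast
  then have "p @ b' \<in> branch b'"
    using branch_transfer moves_labels by metis
  then show ?thesis
    using b by (auto simp: graft_append ungraft_append core'_iff)
qed

lemma inj_on_graft: "inj_on graft core'"
  using graft_core by (metis inj_on_inverseI)

text \<open>
  Grafting is compatible with the tree structure of the core, and every successor of a node of the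
  core is in the core: the nodes left out are at the bottom of the forest.
\<close>

lemma graft_Cons:
  assumes "v \<in> core'" "c # v \<in> nodes G'"
  shows "c # v \<in> core' \<and> graft (c # v) = c # graft v"
proof -
  obtain l i where c: "c = (l, i)" by (cases c)
  have v: "v \<noteq> []"
    using assms(1) by (auto simp: core'_iff dest: nodes_not_Nil branch_not_Nil moves_labels)
  then have i: "i < count (succs (node_label v)) l"
    using assms(2) by (simp add: c Cons_in_nodes)
  from assms(1)[unfolded core'_iff] show ?thesis
  proof
    assume "v \<in> nodes F"
    moreover from this have "c # v \<in> nodes F" using v i by (simp add: c Cons_in_nodes)
    ultimately show ?thesis by (simp add: graft_F core'_iff)
  next
    assume "\<exists>(b', b) \<in> set moves. v \<in> branch b'"
    then obtain b b' p where b: "(b', b) \<in> set moves" "p @ b' \<in> branch b'" "v = p @ b'"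
      using branch_suffix by blast
    then have "c # v \<in> branch b'" using i by (auto simp: c intro: branch.step)
    moreover have "graft (c # v) = c # graft v"
      using graft_append[OF b(1), of p] graft_append[OF b(1), of "c # p"] by (simp add: b(3))
    ultimately show ?thesis using b(1) core'_iff by blast
  qed
qed

lemma removed_not_in_core: "cutN \<notin> core" "expN \<notin> core" "orN \<notin> core" "tensorN \<notin> core"
proof -
  have F: "p @ cutN \<notin> nodes F" for p
    using nodes_F_not_above_cut[of "p @ cutN" cutN p] by auto
  have nF: "cutN \<notin> nodes F" "expN \<notin> nodes F" "orN \<notin> nodes F" "tensorN \<notin> nodes F"
    using F[of "[]"] F[of "[_]"] F[of "[_, _]"] by (simp_all add: expN_def orN_def tensorN_def)
  obtain c where c: "cutN = [c]" using cut_node_singleton by blast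
  have "\<not> suffix b u" if "(b', b) \<in> set moves" "u \<in> {cutN, expN, orN, tensorN}" for b b' u
    using that by (auto simp: moves_def subtree_defs tensorN_def orN_def expN_def c suffix_Cons)
  then have nb: "u \<notin> branch b" if "(b', b) \<in> set moves" "u \<in> {cutN, expN, orN, tensorN}" for b b' u
    using that branch_suffix by (metis suffixI)
  show "cutN \<notin> core" "expN \<notin> core" "orN \<notin> core" "tensorN \<notin> core"
    using nF nb unfolding core_iff by fastforce+
qed

lemma new_cuts_not_in_core': "cut1N \<notin> core'" "cut2N \<notin> core'"
proof -
  have nF: "cut1N \<notin> nodes F" "cut2N \<notin> nodes F"
    using nodes_F_not_above_cut[of cut1N cut1N "[]"] nodes_F_not_above_cut[of cut2N cut2N "[]"] by auto
  obtain c1 c2 where c: "cut1N = [c1]" "cut2N = [c2]" using cut_node_singleton by blast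
  have "\<not> suffix b' u" if "(b', b) \<in> set moves" "u \<in> {cut1N, cut2N}" for b b' u
    using that by (auto simp: moves_def subtree_defs c suffix_Cons)
  then have nb: "u \<notin> branch b'" if "(b', b) \<in> set moves" "u \<in> {cut1N, cut2N}" for b b' u
    using that branch_suffix by (metis suffixI)
  show "cut1N \<notin> core'" "cut2N \<notin> core'"
    using nF nb unfolding core'_iff by fastforce+
qed

section \<open>Wires and types\<close>

lemma removed_labels:
  "node_label cutN = LCut (Upair (Exp {#Tensor s1 s2#}) (TOr t1 t2))"
  "node_label expN = LTree (Exp {#Tensor s1 s2#})"
  "node_label orN = LTree (TOr t1 t2)"
  "node_label tensorN = LWit (Tensor s1 s2)"
  "node_label cut1N = LCut (Upair s1 t1)"
  "node_label cut2N = LCut (Upair s2 t2)"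
  by (simp_all add: cutN_def expN_def orN_def tensorN_def cut1N_def cut2N_def added_root_def node_label_def)

lemma wire_nodes_core: "wire_nodes G x = {v \<in> core. node_label v = LWit (Wire x)}"
  "wire_nodes G' x = {v \<in> core'. node_label v = LWit (Wire x)}"
  by (auto simp: wire_nodes_def nodes_G nodes_G' removed_labels)

text \<open>
  None of the nodes left out of the cores is a wire, and so the linearity conditions on wires carry
  over.
\<close>

lemma graft_wire_nodes: "wire_nodes G x = graft ` wire_nodes G' x"
  unfolding wire_nodes_core using graft_core ungraft_core by (force simp: image_iff)

text \<open>
  Since there is no expansion tree of type \<open>Bot\<close>, a formula such that both it and its dual are
  inhabited is neither \<open>Top\<close> nor \<open>Bot\<close>. Hence the components of the cut formula are admissible
  cut formulae.
\<close>

lemma typed_roots: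
  assumes "root_typed \<Gamma> (Exp {#Tensor s1 s2#} \<bowtie> TOr t1 t2 :: ('v, 'p) root)"
  shows "root_typed \<Gamma> (s1 \<bowtie> t1 :: ('v, 'p) root) \<and> root_typed \<Gamma> (s2 \<bowtie> t2 :: ('v, 'p) root)"
proof -
  have dual_dual: "dual (dual A) = A" for A :: "'p form" by (induction A) auto
  have no_Bot: "\<not> tree_type \<Gamma> t Bot" for t by (auto elim: tree_type.cases)
  \<comment> \<open>A cut is an unordered pair, so that the type \<open>A\<close> of the rule may be that of either component.\<close>
  from assms obtain A where A: "tree_type \<Gamma> (Exp {#Tensor s1 s2#}) A" "tree_type \<Gamma> (TOr t1 t2) (dual A)"
    by cases (metis Upair_inject dual_dual)
  from A(2) obtain B1 B2 where B: "dual A = Or B1 B2" "tree_type \<Gamma> t1 B1" "tree_type \<Gamma> t2 B2"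
    by cases auto
  from B(1) obtain A1 A2 where A12: "A = And A1 A2" "B1 = dual A1" "B2 = dual A2"
    by (cases A) auto
  from A(1) have "wit_type \<Gamma> (Tensor s1 s2) (WTensor A1 A2)"
    unfolding A12(1) by cases auto
  then have s: "tree_type \<Gamma> s1 A1" "tree_type \<Gamma> s2 A2" by (cases, simp)+
  have "A1 \<noteq> Top \<and> A1 \<noteq> Bot" "A2 \<noteq> Top \<and> A2 \<noteq> Bot"
    using s B(2,3) no_Bot unfolding A12(2,3) by auto
  then show ?thesis using s B(2,3) unfolding A12(2,3) by (blast intro: root_typed.intros)
qed

lemma typed_forest_reduct:
  assumes "typed_forest G"
  shows "typed_forest G'"
proof -
  from assms obtain \<Gamma> where "\<forall>r \<in># G. root_typed \<Gamma> r"
    unfolding typed_forest_def by blast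
  then have "\<forall>r \<in># G'. root_typed \<Gamma> r"
    using typed_roots[of \<Gamma>] by (auto simp: G_def G'_def)
  moreover have "u = v" if "u \<in> wire_nodes G' x" "v \<in> wire_nodes G' x" for u v x
  proof -
    have "graft u = graft v"
      using assms that unfolding typed_forest_def graft_wire_nodes by blast
    then show ?thesis using that inj_on_graft by (simp add: wire_nodes_core inj_on_eq_iff)
  qed
  moreover have "wire_nodes G' x \<noteq> {} \<longleftrightarrow> wire_nodes G' (dual_wire x) \<noteq> {}" for x
    using assms unfolding typed_forest_def graft_wire_nodes by simp
  ultimately show ?thesis unfolding typed_forest_def by blast
qed

section \<open>Switchings and acyclicity\<close>

text \<open>
  Copying a switching of \<open>G'\<close> along the isomorphism of the cores leaves two nodes without a
  choice. The sum \<open>expN\<close> has only one successor; the choice \<open>c\<close> at \<open>orN\<close> is free, and both values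
  of it are used below.
\<close>

definition lift_switching ::
  "'v label \<times> nat \<Rightarrow> ('v node \<Rightarrow> 'v label \<times> nat) \<Rightarrow> 'v node \<Rightarrow> 'v label \<times> nat" where
  "lift_switching c \<sigma> u =
     (if u = orN then c else if u = expN then (LWit (Tensor s1 s2), 0) else \<sigma> (ungraft u))"

lemma lift_switching_graft: "v \<in> core' \<Longrightarrow> lift_switching c \<sigma> (graft v) = \<sigma> v"
  using graft_core[of v] removed_not_in_core by (auto simp: lift_switching_def)

lemma subtrees_core: "s1N \<in> core" "s2N \<in> core" "t1N \<in> core" "t2N \<in> core"
  "s1N' \<in> core'" "s2N' \<in> core'" "t1N' \<in> core'" "t2N' \<in> core'"
  by (auto simp: core_def core'_def intro: branch.base)

lemma switching_lift:
  assumes "switching G' \<sigma>" "c # orN \<in> {t1N, t2N}"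
  shows "switching G (lift_switching c \<sigma>)"
  unfolding switching_def
proof (intro ballI impI)
  fix u assume u: "u \<in> nodes G" "switched (node_label u)"
  show "lift_switching c \<sigma> u # u \<in> nodes G"
  proof (cases "u \<in> core")
    case True
    then obtain v where v: "v \<in> core'" "u = graft v"
      using ungraft_core by metis
    then have "\<sigma> v # v \<in> nodes G'"
      using assms(1) u(2) graft_core[OF v(1)] by (auto simp: switching_def nodes_G')
    then show ?thesis
      using graft_Cons[OF v(1)] graft_core[of "\<sigma> v # v"] v
      by (simp add: lift_switching_graft nodes_G)
  next
    case False
    then have "u = orN \<or> u = expN"
      using u by (auto simp: nodes_G removed_labels)
    then show ?thesis
      using assms(2) subtrees_core
      by (auto simp: lift_switching_def nodes_G tensorN_def orN_def expN_def)
  qed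
qed

lemma parent_edge_in_switching_graph:
  "c # v \<in> nodes H \<Longrightarrow> v \<noteq> [] \<Longrightarrow> (switched (node_label v) \<Longrightarrow> c = \<sigma> v) \<Longrightarrow>
     {c # v, v} \<in> switching_graph H \<sigma>"
  unfolding switching_graph_eq by blast

text \<open>
  The middle of the cut in \<open>G\<close> contributes a path between \<open>s1N\<close> and \<open>s2N\<close> and one from
  either of them to the chosen one of \<open>t1N\<close> and \<open>t2N\<close>.
\<close>

lemma detour_edges:
  assumes "c # orN \<in> {t1N, t2N}"
  shows "{{tensorN, s1N}, {tensorN, s2N}, {tensorN, expN}, {expN, cutN}, {cutN, orN},
    {orN, c # orN}} \<subseteq> switching_graph G (lift_switching c \<sigma>)"
proof -
  have neq: "expN \<noteq> orN" by (simp add: expN_def orN_def)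
  have [simp]: "cutN \<noteq> []" by (simp add: cutN_def added_root_def)
  have nodes: "tensorN \<in> nodes G" "s1N \<in> nodes G" "s2N \<in> nodes G" "expN \<in> nodes G"
    "orN \<in> nodes G" "c # orN \<in> nodes G"
    using assms subtrees_core by (auto simp: nodes_G)
  have [simp]: "tensorN \<noteq> []" by (simp add: tensorN_def)
  have "{s1N, tensorN} \<in> switching_graph G (lift_switching c \<sigma>)"
    "{s2N, tensorN} \<in> switching_graph G (lift_switching c \<sigma>)"
    using nodes unfolding s1N_def s2N_def
    by (intro parent_edge_in_switching_graph; simp add: removed_labels)+
  moreover have "{tensorN, expN} \<in> switching_graph G (lift_switching c \<sigma>)"
    using nodes neq unfolding tensorN_def
    by (intro parent_edge_in_switching_graph) (auto simp: lift_switching_def expN_def)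
  moreover have "{expN, cutN} \<in> switching_graph G (lift_switching c \<sigma>)"
    "{orN, cutN} \<in> switching_graph G (lift_switching c \<sigma>)"
    using nodes unfolding expN_def orN_def
    by (auto intro!: parent_edge_in_switching_graph simp: removed_labels)
  moreover have "{c # orN, orN} \<in> switching_graph G (lift_switching c \<sigma>)"
    using nodes by (intro parent_edge_in_switching_graph) (auto simp: lift_switching_def orN_def)
  ultimately show ?thesis by (simp add: insert_commute)
qed

definition core_edges :: "('v node \<Rightarrow> 'v label \<times> nat) \<Rightarrow> 'v node set set" where
  "core_edges \<sigma> = {E \<in> switching_graph G' \<sigma>. E \<subseteq> core'}"

lemma switching_graph_reduct:
  "switching_graph G' \<sigma> \<subseteq>
     {{cut2N, s2N'}, {cut2N, t2N'}} \<union> ({{cut1N, s1N'}, {cut1N, t1N'}} \<union> core_edges \<sigma>)"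
proof
  fix E assume E: "E \<in> switching_graph G' \<sigma>"
  then consider (parent) c v where "E = {c # v, v}" "c # v \<in> nodes G'" "v \<noteq> []"
    | (wire) u v x where "E = {u, v}" "u \<in> wire_nodes G' x" "v \<in> wire_nodes G' (dual_wire x)"
    unfolding switching_graph_eq by blast
  then show "E \<in> {{cut2N, s2N'}, {cut2N, t2N'}} \<union>
      ({{cut1N, s1N'}, {cut1N, t1N'}} \<union> core_edges \<sigma>)"
  proof cases
    case parent
    obtain l i where c: "c = (l, i)" by (cases c)
    have v: "v \<in> nodes G'" "c \<in> steps (succs (node_label v))"
      using parent by (simp_all add: c Cons_in_nodes steps_def)
    then consider "v \<in> core'" | "v = cut1N" | "v = cut2N" by (auto simp: nodes_G')
    then show ?thesis
    proof cases
      case 1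
      then have "c # v \<in> core'" using graft_Cons parent(2) by blast
      with 1 show ?thesis using E unfolding core_edges_def parent(1) by blast
    next
      case 2
      then have "c # v \<in> {s1N', t1N'}"
        using v(2) by (simp add: removed_labels steps_pair s1N'_def t1N'_def)
      with 2 show ?thesis unfolding parent(1) by (auto simp: insert_commute)
    next
      case 3
      then have "c # v \<in> {s2N', t2N'}"
        using v(2) by (simp add: removed_labels steps_pair s2N'_def t2N'_def)
      with 3 show ?thesis unfolding parent(1) by (auto simp: insert_commute)
    qed
  next
    case wire
    then show ?thesis using E by (auto simp: core_edges_def wire_nodes_core)
  qed
qed

lemma graft_core_edges:
  "(`) graft ` core_edges \<sigma> \<subseteq> switching_graph G (lift_switching c \<sigma>)"
proof (intro image_subsetI)
  fix E assume "E \<in> core_edges \<sigma>"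
  then have E: "E \<in> switching_graph G' \<sigma>" "E \<subseteq> core'" by (simp_all add: core_edges_def)
  from E(1) consider (parent) c v where "E = {c # v, v}" "c # v \<in> nodes G'" "v \<noteq> []"
      "switched (node_label v) \<longrightarrow> c = \<sigma> v"
    | (wire) u v x where "E = {u, v}" "u \<in> wire_nodes G' x" "v \<in> wire_nodes G' (dual_wire x)"
    unfolding switching_graph_eq by blast
  then show "graft ` E \<in> switching_graph G (lift_switching c \<sigma>)"
  proof cases
    case (parent d v)
    have v: "v \<in> core'" "d # v \<in> core'" using E(2) parent(1) by auto
    have "graft (d # v) = d # graft v" using graft_Cons v(1) parent(2) by blast
    moreover have "d # graft v \<in> nodes G"
      using graft_core[OF v(2)] calculation by (simp add: nodes_G)
    moreover have "graft v \<in> nodes G" using graft_core[OF v(1)] by (simp add: nodes_G)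
    ultimately show ?thesis
      using parent(1,4) graft_core[OF v(1)] nodes_not_Nil
      by (auto intro!: parent_edge_in_switching_graph simp: lift_switching_graft v(1))
  next
    case (wire u v x)
    then have "graft u \<in> wire_nodes G x" "graft v \<in> wire_nodes G (dual_wire x)"
      by (auto simp: graft_wire_nodes)
    then show ?thesis using wire(1) unfolding switching_graph_eq by auto
  qed
qed

text \<open>
  Each of these connections would close a cycle with a path through the removed nodes of \<open>G\<close>.
  The connection between \<open>t1N\<close> and \<open>t2N\<close> is missing from the list: it is not excluded, as no
  switching keeps both edges into \<open>orN\<close>.
\<close>

lemma subtrees_not_connected:
  assumes "AC G" "switching G' \<sigma>"
  defines "H \<equiv> (`) graft ` core_edges \<sigma>"
  shows "acyclic_graph H" "\<not> connects H s1N s2N"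
    "t \<in> {t1N, t2N} \<Longrightarrow> \<not> connects H s1N t" "t \<in> {t1N, t2N} \<Longrightarrow> \<not> connects H s2N t"
proof -
  have H: "\<Union>H \<subseteq> core"
    using graft_core by (auto simp: H_def core_edges_def)
  have acyc: "acyclic_graph (H \<union> {{tensorN, s1N}, {tensorN, s2N}, {tensorN, expN}, {expN, cutN},
      {cutN, orN}, {orN, t}})" if t: "t \<in> {t1N, t2N}" for t
  proof -
    obtain c where c: "t = c # orN" using t by (auto simp: t1N_def t2N_def)
    have "acyclic_graph (switching_graph G (lift_switching c \<sigma>))"
      using assms(1) switching_lift[OF assms(2)] t unfolding AC_def c by blast
    then show ?thesis
      by (rule acyclic_subset)
        (use graft_core_edges[of \<sigma> c] detour_edges[of c \<sigma>] t in \<open>simp add: H_def c\<close>)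
  qed
  show "acyclic_graph H" using acyc[of t1N] acyclic_subset by (metis Un_upper1 insertI1)
  have "s1N \<noteq> s2N" by (auto simp: s1N_def s2N_def)
  \<comment> \<open>All cycles in question run through the edge from \<open>tensorN\<close> to \<open>s1N\<close> or \<open>s2N\<close>.\<close>
  have bridge: "\<not> connects (H \<union> {{tensorN, s'}, {tensorN, expN}, {expN, cutN},
      {cutN, orN}, {orN, t}}) tensorN s"
    if "t \<in> {t1N, t2N}" "(s, s') \<in> {(s1N, s2N), (s2N, s1N)}" for s s' t
  proof
    let ?P = "{{tensorN, s'}, {tensorN, expN}, {expN, cutN}, {cutN, orN}, {orN, t}}"
    assume "connects (H \<union> ?P) tensorN s"
    moreover have "{tensorN, s} \<notin> H" using H removed_not_in_core by blast
    moreover have "{tensorN, s} \<notin> ?P"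
    proof -
      have "s \<in> core" "s' \<in> core" "t \<in> core" "s \<noteq> s'"
        using that subtrees_core \<open>s1N \<noteq> s2N\<close> by auto
      moreover have "tensorN \<noteq> expN" "tensorN \<noteq> cutN" "tensorN \<noteq> orN"
        by (auto simp: tensorN_def expN_def orN_def cutN_def added_root_def)
      ultimately show ?thesis using removed_not_in_core by (auto simp: doubleton_eq_iff)
    qed
    ultimately have "connects (insert {tensorN, s} (H \<union> ?P) - {{tensorN, s}}) tensorN s"
      by (simp add: connects_mono)
    moreover have "acyclic_graph (insert {tensorN, s} (H \<union> ?P))"
      using acyc[OF that(1)] by (rule acyclic_subset) (use that(2) in auto)
    moreover have "tensorN \<noteq> s" using that(2) subtrees_core removed_not_in_core by auto
    ultimately show False using acyclic_edge_is_bridge[OF _ insertI1] by metis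
  qed
  have no_t: "\<not> connects H s t" if t: "t \<in> {t1N, t2N}" and s: "s \<in> {s1N, s2N}" for s t
  proof
    assume st: "connects H s t"
    obtain s' where s': "(s, s') \<in> {(s1N, s2N), (s2N, s1N)}" using s by blast
    let ?E = "H \<union> {{tensorN, s'}, {tensorN, expN}, {expN, cutN}, {cutN, orN}, {orN, t}}"
    have "connects ?E tensorN expN" "connects ?E expN cutN" "connects ?E cutN orN" "connects ?E orN t"
      by (rule connects_edge; simp)+
    moreover have "connects ?E t s" unfolding connects_sym[of _ t] by (rule connects_mono[OF st Un_upper1])
    ultimately have "connects ?E tensorN s" by (meson connects_trans)
    with bridge[OF t s'] show False ..
  qed
  then show "t \<in> {t1N, t2N} \<Longrightarrow> \<not> connects H s1N t" "t \<in> {t1N, t2N} \<Longrightarrow> \<not> connects H s2N t"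
    by blast+
  show "\<not> connects H s1N s2N"
  proof
    assume *: "connects H s1N s2N"
    let ?E = "H \<union> {{tensorN, s2N}, {tensorN, expN}, {expN, cutN}, {cutN, orN}, {orN, t1N}}"
    have "connects ?E tensorN s2N" by (rule connects_edge) simp
    moreover have "connects ?E s2N s1N" unfolding connects_sym[of _ s2N] by (rule connects_mono[OF * Un_upper1])
    ultimately have "connects ?E tensorN s1N" by (meson connects_trans)
    then show False using bridge[of t1N s1N s2N] by simp
  qed
qed

text \<open>
  The two cuts of \<open>G'\<close> are inserted one after the other. The first is harmless since \<open>s1N'\<close> and
  \<open>t1N'\<close> are not connected. In its presence, a walk from \<open>s2N'\<close> to \<open>t2N'\<close> either stays in the
  core or goes first from \<open>s2N'\<close> to \<open>s1N'\<close> or to \<open>t1N'\<close> inside the core; all three are excluded,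
  so the second cut closes no cycle either.
\<close>

lemma AC_reduct:
  assumes "AC G"
  shows "AC G'"
  unfolding AC_def
proof (intro allI impI)
  fix \<sigma> assume \<sigma>: "switching G' \<sigma>"
  let ?H = "core_edges \<sigma>"
  let ?E1 = "{{cut1N, s1N'}, {cut1N, t1N'}} \<union> ?H"
  have H: "\<Union>?H \<subseteq> core'" by (auto simp: core_edges_def)
  have graft: "graft s1N' = s1N" "graft s2N' = s2N" "graft t1N' = t1N" "graft t2N' = t2N"
    using graft_append[where p = "[]"] by (simp_all add: moves_def)
  have sep: "\<not> connects ?H s1N' s2N'" "\<not> connects ?H s1N' t1N'" "\<not> connects ?H s2N' t2N'"
    "\<not> connects ?H s2N' t1N'"
    using subtrees_not_connected(2)[OF assms \<sigma>] subtrees_not_connected(3,4)[OF assms \<sigma>, of t1N]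
      subtrees_not_connected(4)[OF assms \<sigma>, of t2N] connects_image[where f = graft and E = ?H]
    unfolding graft[symmetric] by blast+
  have cut1: "cut1N \<notin> \<Union>?H" "cut1N \<noteq> s1N'" "cut1N \<noteq> t1N'" "s2N' \<noteq> cut1N" "t2N' \<noteq> cut1N"
    using H new_cuts_not_in_core' subtrees_core by auto
  have cut2: "cut2N \<notin> \<Union>?E1" "cut2N \<noteq> s2N'" "cut2N \<noteq> t2N'"
    using H new_cuts_not_in_core' subtrees_core cuts_distinct by auto
  have "acyclic_graph ?H"
    using subtrees_not_connected(1)[OF assms \<sigma>] inj_on_subset[OF inj_on_graft H] by (rule acyclic_inj_image)
  then have "acyclic_graph ?E1"
    using sep(2) cut1(1-3) by (rule acyclic_subdivided_edge)
  moreover have "\<not> connects ?E1 s2N' t2N'"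
    using connects_subdivided_edge[OF _ cut1(1,4,5)] sep connects_sym by metis
  ultimately have "acyclic_graph ({{cut2N, s2N'}, {cut2N, t2N'}} \<union> ?E1)"
    using cut2 by (rule acyclic_subdivided_edge)
  then show "acyclic_graph (switching_graph G' \<sigma>)"
    using switching_graph_reduct by (rule acyclic_subset)
qed

end

theorem proposition56:
  fixes F G G' :: "('v, 'p) forest" and s1 s2 t1 t2 :: "'v etree"
  assumes "G = F + {#Exp {#Tensor s1 s2#} \<bowtie> TOr t1 t2#}"
    and "G' = F + {#s1 \<bowtie> t1, s2 \<bowtie> t2#}"
    and "typed_forest G" and "AC G"
  shows "typed_forest G' \<and> AC G' \<and> forest_type G' = forest_type G"
proof -
  interpret reduction: tensor_or_cut F s1 s2 t1 t2 .
  have G: "G = reduction.G" "G' = reduction.G'"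
    by (simp_all add: assms(1,2) reduction.G_def reduction.G'_def)
  moreover have "forest_type G' = forest_type G"
    by (simp add: assms(1,2) forest_type_def)
  ultimately show ?thesis
    using reduction.typed_forest_reduct reduction.AC_reduct assms(3,4) by simp
qed

end
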